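(* Let $X$ be a two-dimensional polyhedral Banach space, $Y$ a normed linear space, and $\varepsilon\in[0,1)$. If $T\in\mathcal{L}(X,Y)$ with $\|T\|=1$ is $BD^\varepsilon$-P at an extreme point $x\in S_X$ of the unit ball $B_X$ and $Tx\neq0$, then $T$ is $BD^\eta$-P for some $\eta\in[0,1)$.
   Context: All normed spaces are real; $B_X$ and $S_X$ are the closed unit ball and unit sphere of $X$; $\mathcal{L}(X,Y)$ is the space of bounded linear operators from $X$ to $Y$ with the operator norm. A finite-dimensional Banach space is polyhedral if its unit ball has only finitely many extreme points. $x\perp_B y$ means $\|x+\lambda y\|\ge\|x\|$ for all $\lambda\in\mathbb{R}$. For $\varepsilon\in[0,1)$, $x\perp_{D^\varepsilon}y$ means $\|x+\lambda y\|\ge\sqrt{1-\varepsilon^2}\,\|x\|$ for all $\lambda\in\mathbb{R}$. For $\eta\in[0,1)$, $T$ is $BD^\eta$-P at $x\in X$ if for all $y\in X$, $x\perp_B y$ implies $Tx\perp_{D^\eta}Ty$; $T$ is $BD^\eta$-P if this holds at every $x\in X$ (with the same $\eta$). *)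

theory Defs
  imports "HOL-Analysis.Analysis"
begin

text \<open>A finite-dimensional normed space whose closed unit ball has only finitely many
  extreme points. Finite dimension is stated as the existence of a finite spanning set, since
  the library's \<open>euclidean_space\<close> class would force the norm to come from an inner product.\<close>

definition polyhedral_space :: "'a::real_normed_vector itself \<Rightarrow> bool"
  where "polyhedral_space (_ :: 'a itself) \<longleftrightarrow>
    (\<exists>B. finite B \<and> span B = (UNIV :: 'a set)) \<and>
    finite {x :: 'a. x extreme_point_of (cball 0 1)}"

definition birkhoff_orthogonal :: "'a::real_normed_vector \<Rightarrow> 'a \<Rightarrow> bool"
  (infix \<open>\<bottom>\<^sub>B\<close> 50)
  where "x \<bottom>\<^sub>B y \<longleftrightarrow> (\<forall>c::real. norm (x + c *\<^sub>R y) \<ge> norm x)"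

text \<open>The parameter is only meaningful in \<open>{0..<1}\<close>; this range is imposed where the
  notions below are used.\<close>

definition D_orthogonal :: "real \<Rightarrow> 'a::real_normed_vector \<Rightarrow> 'a \<Rightarrow> bool"
  where "D_orthogonal \<epsilon> x y \<longleftrightarrow>
    (\<forall>c::real. norm (x + c *\<^sub>R y) \<ge> sqrt (1 - \<epsilon>\<^sup>2) * norm x)"

definition BD_preserving_at ::
    "real \<Rightarrow> ('a::real_normed_vector \<Rightarrow>\<^sub>L 'b::real_normed_vector) \<Rightarrow> 'a \<Rightarrow> bool"
  where "BD_preserving_at \<eta> T x \<longleftrightarrow>
    (\<forall>y. x \<bottom>\<^sub>B y \<longrightarrow> D_orthogonal \<eta> (blinfun_apply T x) (blinfun_apply T y))"

definition BD_preserving ::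
    "real \<Rightarrow> ('a::real_normed_vector \<Rightarrow>\<^sub>L 'b::real_normed_vector) \<Rightarrow> bool"
  where "BD_preserving \<eta> T \<longleftrightarrow> (\<forall>x. BD_preserving_at \<eta> T x)"

end

theory Submission
  imports Defs
begin

text \<open>A vertex \<open>x\<close> of a polytope is exposed by an open set of functionals, and every
  functional exposing \<open>x\<close> on the unit ball has its kernel Birkhoff orthogonal to \<open>x\<close>. If \<open>T\<close>
  killed some \<open>u \<noteq> 0\<close>, one of these functionals \<open>a\<close> would satisfy \<open>a u \<noteq> 0\<close>; then
  \<open>y = x - (a x / a u) u\<close> is orthogonal to \<open>x\<close> while \<open>T y = T x \<noteq> 0\<close>, so \<open>T x\<close> is not
  \<open>D\<close>-orthogonal to \<open>T y\<close>. Hence \<open>T\<close> is injective, so bounded below by some \<open>m > 0\<close>, and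
  \<open>\<eta> = sqrt (1 - m\<^sup>2)\<close> works at every point. Euclidean coordinates are used
  because the convexity library covers only \<open>euclidean_space\<close>.\<close>

text \<open>The norm of \<open>f\<close> attains its minimum on the compact unit sphere; injectivity
  makes this minimum positive, and homogeneity carries it to all vectors.\<close>

lemma linear_inj_imp_bounded_below:
  fixes f :: "'e::euclidean_space \<Rightarrow> 'b::real_normed_vector"
  assumes "linear f" "inj f"
  obtains m where "m > 0" "\<And>v. m * norm v \<le> norm (f v)"
proof -
  have cont: "continuous_on (sphere 0 1) (\<lambda>v. norm (f v))"
    using assms(1) by (intro continuous_on_norm linear_continuous_on)
      (simp add: linear_conv_bounded_linear)
  have "sphere (0::'e) 1 \<noteq> {}"
    by (simp add: sphere_eq_empty)
  then obtain s where s: "s \<in> sphere 0 1" "\<And>v. v \<in> sphere 0 1 \<Longrightarrow> norm (f s) \<le> norm (f v)"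
    using continuous_attains_inf[OF compact_sphere _ cont] by auto
  have "f s \<noteq> 0"
    using s(1) assms by (auto simp: linear_injective_0)
  moreover have "norm (f s) * norm v \<le> norm (f v)" for v
  proof (cases "v = 0")
    case False
    then have "norm (f s) \<le> norm (f (v /\<^sub>R norm v))"
      by (intro s(2)) simp
    also have "\<dots> = norm (f v) / norm v"
      using assms(1) by (simp add: linear_cmul divide_inverse mult.commute)
    finally show ?thesis
      using False by (simp add: field_simps)
  qed simp
  ultimately show thesis
    using that[of "norm (f s)"] by simp
qed

text \<open>A hyperplane strictly separates \<open>p\<close> from the hull of the other extreme
  points. As these are finitely many, the strict inequalities at them cut out an open set of
  functionals.\<close>

lemma extreme_point_exposing_open_set:
  fixes K :: "'e::euclidean_space set"
  assumes "compact K" "convex K" "finite {e. e extreme_point_of K}" "p extreme_point_of K"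
  obtains U where "open U" "U \<noteq> {}" "\<And>a k. a \<in> U \<Longrightarrow> k \<in> K \<Longrightarrow> a \<bullet> k \<le> a \<bullet> p"
proof -
  define E where "E = {e. e extreme_point_of K} - {p}"
  define U where "U = (\<Inter>e\<in>E. {a. a \<bullet> e < a \<bullet> p})"
  have E: "finite E" "p \<notin> E"
    using assms(3) by (auto simp: E_def)
  have K: "K = convex hull (insert p E)"
  proof -
    have "insert p E = {e. e extreme_point_of K}"
      using assms(4) by (auto simp: E_def)
    with Krein_Milman_Minkowski[OF assms(1,2)] show ?thesis
      by simp
  qed
  \<comment> \<open>Otherwise \<open>E\<close> alone would generate \<open>K\<close>, and every
    extreme point of a convex hull belongs to the generating set.\<close>
  have "p \<notin> convex hull E"
  proof
    assume "p \<in> convex hull E"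
    then have "K = convex hull E"
      by (simp add: K hull_redundant)
    with assms(4) E(2) show False
      using extreme_point_of_convex_hull by blast
  qed
  moreover have "closed (convex hull E)"
    using E(1) by (simp add: compact_imp_closed finite_imp_compact_convex_hull)
  ultimately obtain a b where ab: "a \<bullet> p < b" "\<And>e. e \<in> convex hull E \<Longrightarrow> b < a \<bullet> e"
    using separating_hyperplane_closed_point[OF convex_convex_hull] by metis
  \<comment> \<open>Separation puts \<open>p\<close> on the low side of \<open>a\<close>, whereas
    \<open>U\<close> asks for a maximum at \<open>p\<close>; hence the sign.\<close>
  have "- a \<in> U"
    using ab by (force simp: U_def intro: hull_inc)
  moreover have "open U"
    unfolding U_def using E(1)
    by (intro open_INT ballI open_Collect_less continuous_intros)
  moreover have "a \<bullet> k \<le> a \<bullet> p" if "a \<in> U" "k \<in> K" for a k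
  proof -
    have "K \<subseteq> {k. a \<bullet> k \<le> a \<bullet> p}"
      unfolding K using that(1)
      by (intro hull_minimal convex_halfspace_le) (auto simp: U_def less_imp_le)
    with that(2) show ?thesis
      by auto
  qed
  ultimately show thesis
    using that by blast
qed

text \<open>The orthogonal complement of a nonzero vector has empty interior: a small shift along
  \<open>u\<close> leaves it.\<close>

lemma open_not_orthogonal:
  fixes u :: "'e::real_inner"
  assumes "open U" "U \<noteq> {}" "u \<noteq> 0"
  obtains a where "a \<in> U" "a \<bullet> u \<noteq> 0"
proof -
  obtain a where a: "a \<in> U"
    using assms(2) by auto
  then obtain e where e: "e > 0" "ball a e \<subseteq> U"
    using assms(1) open_contains_ball by blast
  define a' where "a' = a + (e / (2 * norm u)) *\<^sub>R u"
  have "a' \<in> U"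
    using e assms(3) by (intro subsetD[OF e(2)]) (simp add: a'_def dist_norm)
  moreover have "a' \<bullet> u \<noteq> a \<bullet> u"
    using e(1) assms(3) by (simp add: a'_def inner_add_left)
  ultimately show thesis
    using a that by metis
qed

text \<open>Since \<open>g\<close> is constant along the line \<open>x + c *\<^sub>R y\<close>, a
  point of norm below 1 on it could be scaled up within the ball to a value above the maximum
  \<open>g x\<close>. The vector \<open>w\<close> witnesses that \<open>g\<close> is nonzero, which
  forces \<open>g x > 0\<close>.\<close>

lemma exposing_functional_imp_birkhoff_orthogonal:
  fixes g :: "'a::real_normed_vector \<Rightarrow> real"
  assumes "linear g" "norm x = 1" "\<And>z. norm z \<le> 1 \<Longrightarrow> g z \<le> g x" "g y = 0" "g w \<noteq> 0"
  shows "x \<bottom>\<^sub>B y"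
  unfolding birkhoff_orthogonal_def
proof
  fix c
  have "w \<noteq> 0"
    using assms(1,5) linear_0 by blast
  have "g (sgn w) \<noteq> 0"
    using assms(1,5) \<open>w \<noteq> 0\<close> by (simp add: sgn_div_norm linear_cmul)
  moreover have "g (sgn w) \<le> g x" "g (- sgn w) \<le> g x"
    using \<open>w \<noteq> 0\<close> by (auto intro!: assms(3) simp: norm_sgn)
  ultimately have pos: "g x > 0"
    using assms(1) by (simp add: linear_neg)
  show "norm x \<le> norm (x + c *\<^sub>R y)"
  proof (rule ccontr)
    assume "\<not> norm x \<le> norm (x + c *\<^sub>R y)"
    \<comment> \<open>Dividing by \<open>r\<close> instead of the norm avoids a separate case for
      \<open>x + c *\<^sub>R y = 0\<close>.\<close>
    then obtain r where r: "norm (x + c *\<^sub>R y) < r" "r < 1"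
      using assms(2) dense[of "norm (x + c *\<^sub>R y)" 1] by auto
    then have "r > 0"
      using norm_ge_zero order_le_less_trans by blast
    then have "norm ((x + c *\<^sub>R y) /\<^sub>R r) \<le> 1"
      using r unfolding norm_scaleR by (simp add: field_simps)
    then have "g ((x + c *\<^sub>R y) /\<^sub>R r) \<le> g x"
      by (rule assms(3))
    then have "g x \<le> r * g x"
      using assms(1,4) \<open>r > 0\<close> by (simp add: linear_cmul linear_add field_simps)
    with pos r show False
      by simp
  qed
qed

lemma extreme_point_of_linear_vimage:
  assumes "linear f" "bij f"
  shows "v extreme_point_of (f -` S) \<longleftrightarrow> f v extreme_point_of S"
proof -
  have "f ` (f -` S) = S"
    using assms(2) by (simp add: bij_is_surj surj_image_vimage_eq)
  moreover have "{v} face_of (f -` S) \<longleftrightarrow> f ` {v} face_of f ` (f -` S)"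
    using face_of_linear_image[OF assms(1) bij_is_inj[OF assms(2)]] by blast
  ultimately show ?thesis
    by (simp add: face_of_singleton)
qed

text \<open>The coordinates \<open>\<phi>\<close> turn the unit ball into a compact convex set
  \<open>K\<close> to which the separation argument applies. The lower bound is first obtained for
  \<open>T\<close> composed with \<open>\<phi>\<close>, then moved back to the norm of the
  domain.\<close>

lemma BD_preserving_at_extreme_point_imp_bounded_below:
  fixes T :: "'a::real_normed_vector \<Rightarrow>\<^sub>L 'b::real_normed_vector"
    and \<phi> :: "'e::euclidean_space \<Rightarrow> 'a"
  assumes \<phi>: "linear \<phi>" "bij \<phi>"
    and fin: "finite {x :: 'a. x extreme_point_of (cball 0 1)}"
    and \<epsilon>: "\<epsilon> \<in> {0..<1}"
    and x: "norm x = 1" "x extreme_point_of (cball 0 1)"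
    and BD: "BD_preserving_at \<epsilon> T x"
    and Tx: "T x \<noteq> 0"
  obtains m where "m > 0" "\<And>z. m * norm z \<le> norm (T z)"
proof -
  define \<psi> where "\<psi> = inv \<phi>"
  have \<psi>\<phi>: "\<psi> (\<phi> v) = v" and \<phi>\<psi>: "\<phi> (\<psi> z) = z" for v z
    using \<phi>(2) by (auto simp: \<psi>_def bij_is_inj bij_is_surj surj_f_inv_f)
  have "linear \<psi>"
    by (rule linearI) (metis \<psi>\<phi> \<phi>\<psi> linear_add[OF \<phi>(1)], metis \<psi>\<phi> \<phi>\<psi> linear_cmul[OF \<phi>(1)])
  have bl: "bounded_linear \<phi>"
    using \<phi>(1) by (simp add: linear_conv_bounded_linear)
  obtain m where m: "m > 0" "\<And>v. m * norm v \<le> norm (\<phi> v)"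
    using linear_inj_imp_bounded_below[OF \<phi>(1) bij_is_inj[OF \<phi>(2)]] by metis
  define K where "K = \<phi> -` cball 0 1"
  have extr: "v extreme_point_of K \<longleftrightarrow> \<phi> v extreme_point_of cball 0 1" for v
    unfolding K_def by (rule extreme_point_of_linear_vimage[OF \<phi>])
  have "closed K"
    unfolding K_def using bl by (intro closed_vimage) (auto simp: linear_continuous_on)
  moreover have "bounded K"
  proof (rule boundedI)
    fix v assume "v \<in> K"
    then have "m * norm v \<le> 1"
      using m(2)[of v] by (simp add: K_def)
    then show "norm v \<le> 1 / m"
      using m(1) by (simp add: field_simps)
  qed
  ultimately have "compact K"
    by (simp add: compact_eq_bounded_closed)
  moreover have "convex K"
    unfolding K_def using \<phi>(1) by (intro convex_linear_vimage convex_cball)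
  moreover have "finite {v. v extreme_point_of K}"
    using finite_vimageI[OF fin bij_is_inj[OF \<phi>(2)]] by (simp add: extr vimage_def)
  moreover have "\<psi> x extreme_point_of K"
    using x(2) by (simp add: extr \<phi>\<psi>)
  ultimately obtain U where U: "open U" "U \<noteq> {}" "\<And>a k. a \<in> U \<Longrightarrow> k \<in> K \<Longrightarrow> a \<bullet> k \<le> a \<bullet> \<psi> x"
    using extreme_point_exposing_open_set by metis
  have ker: "u = 0" if "T (\<phi> u) = 0" for u
  proof (rule ccontr)
    assume "u \<noteq> 0"
    then obtain a where a: "a \<in> U" "a \<bullet> u \<noteq> 0"
      using open_not_orthogonal U(1,2) by metis
    define y where "y = x - (a \<bullet> \<psi> x / (a \<bullet> u)) *\<^sub>R \<phi> u"
    have "x \<bottom>\<^sub>B y"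
    proof (rule exposing_functional_imp_birkhoff_orthogonal)
      show "linear (\<lambda>z. a \<bullet> \<psi> z)"
        using \<open>linear \<psi>\<close> by (auto intro!: linearI simp: linear_add linear_cmul inner_add_right)
      show "a \<bullet> \<psi> z \<le> a \<bullet> \<psi> x" if "norm z \<le> 1" for z
        using that by (intro U(3) a(1)) (simp add: K_def \<phi>\<psi>)
      show "a \<bullet> \<psi> y = 0"
        using a(2) \<open>linear \<psi>\<close> by (simp add: y_def linear_diff linear_cmul \<psi>\<phi> inner_diff_right)
      show "a \<bullet> \<psi> (\<phi> u) \<noteq> 0"
        using a(2) by (simp add: \<psi>\<phi>)
    qed (fact x)
    moreover have "T y = T x"
      using that by (simp add: y_def blinfun.diff_right blinfun.scaleR_right)
    ultimately have "D_orthogonal \<epsilon> (T x) (T x)"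
      using BD by (metis BD_preserving_at_def)
    \<comment> \<open>The choice \<open>c = -1\<close> makes the right side vanish, while the left
      side is positive.\<close>
    then have "sqrt (1 - \<epsilon>\<^sup>2) * norm (T x) \<le> norm (T x + (- 1) *\<^sub>R T x)"
      unfolding D_orthogonal_def by blast
    moreover have "\<epsilon>\<^sup>2 < 1"
      using \<epsilon> by (simp add: power_less_one_iff abs_square_less_1)
    ultimately show False
      using Tx by (simp add: mult_le_0_iff)
  qed
  have "linear (\<lambda>v. T (\<phi> v))"
    using \<phi>(1) by (auto intro!: linearI simp: linear_add linear_cmul blinfun.bilinear_simps)
  moreover from this have "inj (\<lambda>v. T (\<phi> v))"
    using ker by (auto simp: linear_injective_0)
  ultimately obtain l where l: "l > 0" "\<And>v. l * norm v \<le> norm (T (\<phi> v))"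
    using linear_inj_imp_bounded_below by metis
  \<comment> \<open>An upper bound on \<open>\<phi>\<close> is a lower bound on
    \<open>\<psi>\<close>, as needed to replace the Euclidean norm of \<open>\<psi> z\<close> by the
    norm of \<open>z\<close>.\<close>
  obtain C where C: "C > 0" "\<And>v. norm (\<phi> v) \<le> norm v * C"
    using bounded_linear.pos_bounded[OF bl] by metis
  have "l / C * norm z \<le> norm (T z)" for z
  proof -
    have "norm z \<le> norm (\<psi> z) * C"
      using C(2)[of "\<psi> z"] by (simp add: \<phi>\<psi>)
    then have "l / C * norm z \<le> l * norm (\<psi> z)"
      using C(1) l(1) by (simp add: field_simps)
    also have "\<dots> \<le> norm (T z)"
      using l(2)[of "\<psi> z"] by (simp add: \<phi>\<psi>)
    finally show ?thesis .
  qed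
  with that[of "l / C"] show thesis
    using l(1) C(1) by simp
qed

text \<open>The parameter is the solution of \<open>sqrt (1 - \<eta>\<^sup>2) = m\<close>. The
  factor \<open>m\<close> is spent on the lower bound at \<open>x + c *\<^sub>R y\<close>, after
  orthogonality has compared its norm with that of \<open>x\<close>.\<close>

lemma bounded_below_imp_BD_preserving:
  fixes T :: "'a::real_normed_vector \<Rightarrow>\<^sub>L 'b::real_normed_vector"
  assumes "0 \<le> m" "m \<le> 1" "norm T \<le> 1" "\<And>z. m * norm z \<le> norm (T z)"
  shows "BD_preserving (sqrt (1 - m\<^sup>2)) T"
  unfolding BD_preserving_def BD_preserving_at_def D_orthogonal_def
proof (intro allI impI)
  fix x y :: 'a and c :: real
  assume "x \<bottom>\<^sub>B y"
  have "sqrt (1 - (sqrt (1 - m\<^sup>2))\<^sup>2) = m"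
    using assms(1,2) by (simp add: power_le_one)
  moreover have "norm (T x) \<le> norm x"
    using norm_blinfun[of T x] mult_right_mono[OF assms(3), of "norm x"] by simp
  ultimately have "sqrt (1 - (sqrt (1 - m\<^sup>2))\<^sup>2) * norm (T x) \<le> m * norm x"
    using assms(1) by (simp add: mult_left_mono)
  also have "\<dots> \<le> m * norm (x + c *\<^sub>R y)"
    using \<open>x \<bottom>\<^sub>B y\<close> assms(1) by (simp add: birkhoff_orthogonal_def mult_left_mono)
  also have "\<dots> \<le> norm (T x + c *\<^sub>R T y)"
    using assms(4)[of "x + c *\<^sub>R y"] by (simp add: blinfun.bilinear_simps)
  finally show "sqrt (1 - (sqrt (1 - m\<^sup>2))\<^sup>2) * norm (T x) \<le> norm (T x + c *\<^sub>R T y)" .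
qed

text \<open>The type \<open>complex\<close> serves as a concrete two-dimensional Euclidean space,
  with real and imaginary parts as coefficients in a basis.\<close>

lemma dim_2_coordinates:
  assumes "dim (UNIV :: 'a::real_vector set) = 2"
  obtains \<phi> :: "complex \<Rightarrow> 'a::real_vector" where "linear \<phi>" "bij \<phi>"
proof -
  obtain B :: "'a set" where B: "independent B" "UNIV \<subseteq> span B" "card B = 2"
    using basis_exists[of "UNIV :: 'a set"] assms by metis
  then obtain b c where bc: "B = {b, c}" "b \<noteq> c"
    by (auto simp: card_2_iff)
  define \<phi> where "\<phi> z = Re z *\<^sub>R b + Im z *\<^sub>R c" for z
  have "linear \<phi>"
    by (auto intro!: linearI simp: \<phi>_def algebra_simps)
  moreover have "inj \<phi>"
  proof -
    have "z = 0" if "\<phi> z = 0" for z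
    proof -
      define k where "k v = (if v = b then Re z else Im z)" for v
      have "(\<Sum>v\<in>B. k v *\<^sub>R v) = 0"
        using that bc by (simp add: \<phi>_def k_def)
      then have "k b = 0" "k c = 0"
        using independentD[OF B(1), of B k] bc(1) by auto
      with bc(2) show ?thesis
        by (simp add: complex_eq_iff k_def)
    qed
    with \<open>linear \<phi>\<close> show ?thesis
      by (simp add: linear_injective_0)
  qed
  moreover have "surj \<phi>"
    unfolding surj_def
  proof
    fix y :: 'a
    have "y \<in> span {b, c}"
      using B(2) bc(1) by blast
    then obtain r s where "y = r *\<^sub>R b + s *\<^sub>R c"
      by (auto simp: span_insert span_singleton algebra_simps)
    then have "y = \<phi> (Complex r s)"
      by (simp add: \<phi>_def)
    then show "\<exists>z. y = \<phi> z" ..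
  qed
  ultimately show thesis
    using that by (simp add: bij_def)
qed

theorem theorem3p6:
  fixes T :: "'a::banach \<Rightarrow>\<^sub>L 'b::real_normed_vector"
    and x :: 'a
    and \<epsilon> :: real
  assumes "dim (UNIV :: 'a set) = 2"
    and "polyhedral_space TYPE('a)"
    and "\<epsilon> \<in> {0..<1}"
    and "norm T = 1"
    and "norm x = 1"
    and "x extreme_point_of (cball 0 1)"
    and "BD_preserving_at \<epsilon> T x"
    and "blinfun_apply T x \<noteq> 0"
  shows "\<exists>\<eta>\<in>{0..<1}. BD_preserving \<eta> T"
proof -
  obtain \<phi> :: "complex \<Rightarrow> 'a" where "linear \<phi>" "bij \<phi>"
    using dim_2_coordinates assms(1) by metis
  moreover have "finite {x :: 'a. x extreme_point_of (cball 0 1)}"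
    using assms(2) by (simp add: polyhedral_space_def)
  ultimately obtain m where m: "m > 0" "\<And>z. m * norm z \<le> norm (T z)"
    using BD_preserving_at_extreme_point_imp_bounded_below assms(3,5-8) by metis
  \<comment> \<open>Evaluation at the unit vector \<open>x\<close> gives \<open>m \<le> 1\<close>,
    so that the square root below is a parameter in the admissible range.\<close>
  have "m \<le> norm (T x)"
    using m(2)[of x] assms(5) by simp
  also have "\<dots> \<le> 1"
    using norm_blinfun[of T x] assms(4,5) by simp
  finally have "m \<le> 1" .
  then have "BD_preserving (sqrt (1 - m\<^sup>2)) T"
    using m assms(4) by (intro bounded_below_imp_BD_preserving) auto
  moreover have "sqrt (1 - m\<^sup>2) \<in> {0..<1}"
    using m(1) \<open>m \<le> 1\<close> by (simp add: power_le_one)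
  ultimately show ?thesis
    by blast
qed

end
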